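(* Let $K$ be a finite field with $q$ elements and $n\ge4$. Then \[ |C_4(n)|=\begin{cases} q^{3n}-(q^3+q^2+q)q^{2n}+(q^5+q^4+q^3)q^n-q^6,&\gcd(n,4)=1,\\ q^{3n}-(q^3+q^2+q)q^{2n}+2(q^4+q^2)q^{\frac32n}-(q^5+q^4+q^3)q^n+q^6,&\gcd(n,4)=2,\\ q^{3n}+3(q^3+q^2+q)q^{2n}+2(q^4+q^2)q^{\frac32n}+3(q^5+q^4+q^3)q^n+q^6,&\gcd(n,4)=4. \end{cases} \]
   Context: $C_4(n)$ is the set of tuples $(v_1,\dots,v_n)\in(\mathbb{P}^3(K))^n$ such that for every $i\in\{1,\dots,n\}$ the points $v_i,v_{i+1},v_{i+2},v_{i+3}$ (indices mod $n$) are projectively independent, i.e. their lifts in $K^4$ are linearly independent. *)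

theory Defs
  imports "HOL-Analysis.Cartesian_Space" "HOL-Library.Numeral_Type"
begin

text \<open>Points of the projective space of \<open>K\<^sup>m\<close> are the lines through the origin; a lift of a
  point is a nonzero vector on that line.\<close>

definition proj_points :: "('a::field ^ 'm) set set" where
  "proj_points = {p. vec.subspace p \<and> vec.dim p = 1}"

definition is_lift :: "'a::field ^ 'm \<Rightarrow> ('a ^ 'm) set \<Rightarrow> bool" where
  "is_lift x p \<longleftrightarrow> x \<in> p \<and> x \<noteq> 0"

text \<open>Lifts of a point differ by a nonzero scalar, so the choice of the lifts is immaterial.
  Linear independence is that of a family, hence the distinctness condition.\<close>

definition proj_independent :: "('a::field ^ 'm) set list \<Rightarrow> bool" where
  "proj_independent ps \<longleftrightarrow>
     (\<forall>xs. list_all2 is_lift xs ps \<longrightarrow> distinct xs \<and> vec.independent (set xs))"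

text \<open>An \<open>n\<close>-tuple is a list of length \<open>n\<close>, indexed from 0.\<close>

definition C4 :: "nat \<Rightarrow> ('a::field ^ 4) set list set" where
  "C4 n = {v. length v = n \<and> set v \<subseteq> proj_points \<and>
     (\<forall>i<n. proj_independent [v ! i, v ! ((i + 1) mod n), v ! ((i + 2) mod n), v ! ((i + 3) mod n)])}"

end

theory Submission imports Defs begin

text \<open>A tuple in \<open>C\<^sub>4(n)\<close> is the same as a closed walk of length \<open>n\<close> on the complete flags of \<open>K\<^sup>4\<close>,
  through the flags \<open>(v\<^sub>i, v\<^sub>i + v\<^sub>i\<^sub>+\<^sub>1, v\<^sub>i + v\<^sub>i\<^sub>+\<^sub>1 + v\<^sub>i\<^sub>+\<^sub>2)\<close>: consecutive flags are exactly those whose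
  relative position is the Coxeter element \<open>s\<^sub>1 s\<^sub>2 s\<^sub>3\<close> of \<open>S\<^sub>4\<close>. Hence \<open>|C\<^sub>4(n)|\<close> is the trace of the \<open>n\<close>-th
  power of \<open>T = T\<^sub>1 T\<^sub>2 T\<^sub>3\<close>, where \<open>T\<^sub>i\<close> sums a function over the flags that differ in the \<open>i\<close>-th
  subspace only. These operators satisfy the relations of the Hecke algebra of \<open>S\<^sub>4\<close>, in which \<open>T\<close> is
  annihilated by a polynomial of degree 10. The trace of \<open>T\<^sup>n\<close> is the number of flags times the
  coordinate of \<open>T\<^sup>n\<close> at the identity. So both sides of the claim satisfy the same linear recurrence
  of order 10, and it remains to compare ten initial values.\<close>

section \<open>Subspaces of a finite vector space\<close>

text \<open>Adjoining \<open>a\<close> outside the span multiplies the count by the number of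
  scalars: each new vector is \<open>k *s a + s\<close> for exactly one pair.\<close>

lemma card_span_independent:
  fixes B :: "('a::{field,finite} ^ 'n) set"
  assumes "vec.independent B"
  shows "card (vec.span B) = CARD('a) ^ card B"
proof -
  have "finite B" by simp
  then show ?thesis using assms
  proof (induction B rule: finite_induct)
    case empty
    then show ?case by simp
  next
    case (insert a B)
    then have indep: "vec.independent B" and a: "a \<notin> vec.span B"
      by (auto simp: vec.independent_insert split: if_splits)
    have "vec.span (insert a B) = (\<lambda>(k, s). k *s a + s) ` (UNIV \<times> vec.span B)"
    proof (intro equalityI subsetI)
      fix x assume "x \<in> vec.span (insert a B)"
      then obtain k where "x - k *s a \<in> vec.span B" by (auto simp: vec.span_insert)
      then show "x \<in> (\<lambda>(k, s). k *s a + s) ` (UNIV \<times> vec.span B)"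
        by (intro image_eqI[of _ _ "(k, x - k *s a)"]) auto
    qed (auto simp: vec.span_insert, metis add_diff_cancel_left')
    moreover have "inj_on (\<lambda>(k, s). k *s a + s) (UNIV \<times> vec.span B)"
    proof (clarsimp simp: inj_on_def)
      fix k s k' s'
      assume s: "s \<in> vec.span B" "s' \<in> vec.span B" and eq: "k *s a + s = k' *s a + s'"
      have diff: "(k - k') *s a = s' - s"
        using eq by (simp add: vec.scale_left_diff_distrib algebra_simps)
      have "k = k'"
      proof (rule ccontr)
        assume "k \<noteq> k'"
        then have "a = inverse (k - k') *s (s' - s)"
          by (simp flip: diff)
        with a s show False by (simp add: vec.span_diff vec.span_scale)
      qed
      with eq show "k = k' \<and> s = s'" by simp
    qed
    ultimately have "card (vec.span (insert a B)) = CARD('a) * card (vec.span B)"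
      by (simp add: card_image card_cartesian_product)
    with insert indep show ?case by simp
  qed
qed

lemma card_subspace:
  fixes S :: "('a::{field,finite} ^ 'n) set"
  assumes "vec.subspace S"
  shows "card S = CARD('a) ^ vec.dim S"
proof -
  obtain B where B: "B \<subseteq> S" "vec.independent B" "S \<subseteq> vec.span B" "card B = vec.dim S"
    by (rule vec.basis_exists)
  then have "S = vec.span B"
    using assms by (metis vec.span_minimal subset_antisym)
  with B show ?thesis by (metis card_span_independent)
qed

lemma dim_span_Un:
  assumes "vec.subspace A" "vec.subspace B"
  shows "vec.dim (vec.span (A \<union> B)) + vec.dim (A \<inter> B) = vec.dim A + vec.dim B"
proof -
  have "vec.span A = A" "vec.span B = B"
    using assms by auto
  then have "vec.span (A \<union> B) = {x + y |x y. x \<in> A \<and> y \<in> B}"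
    by (simp only: vec.span_Un)
  then show ?thesis
    using vec.dim_sums_Int[OF assms] by simp
qed

text \<open>The points of the projective space of \<open>B / A\<close>, described without quotients.
  In relative dimension 2 they are the choices for one component of a flag.\<close>

definition between :: "('a::field ^ 'n) set \<Rightarrow> ('a ^ 'n) set \<Rightarrow> ('a ^ 'n) set set" where
  "between A B = {C. vec.subspace C \<and> A \<subseteq> C \<and> C \<subseteq> B \<and> vec.dim C = Suc (vec.dim A)}"

text \<open>Each vector of \<open>B - A\<close> lies in just one such \<open>C\<close>, the span of
  \<open>insert v A\<close>, so the sets \<open>C - A\<close> partition
  \<open>B - A\<close>.\<close>

lemma card_between_mult:
  fixes A B :: "('a::{field,finite} ^ 'n) set"
  assumes A: "vec.subspace A" and B: "vec.subspace B" and AB: "A \<subseteq> B"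
  shows "card (between A B) * (CARD('a) ^ Suc (vec.dim A) - CARD('a) ^ vec.dim A)
           = CARD('a) ^ vec.dim B - CARD('a) ^ vec.dim A"
proof -
  have span_eq: "vec.span (insert v A) = C" if "C \<in> between A B" "v \<in> C - A" for v C
  proof (rule vec.subspace_dim_equal)
    show "vec.span (insert v A) \<subseteq> C"
      using that by (intro vec.span_minimal) (auto simp: between_def)
    have "v \<notin> vec.span A" using that A by (metis DiffD2 vec.span_eq_iff)
    then show "vec.dim C \<le> vec.dim (vec.span (insert v A))"
      using that by (auto simp: between_def vec.dim_insert)
  qed (use that in \<open>auto simp: between_def\<close>)
  have cover: "B - A = (\<Union>C\<in>between A B. C - A)"
  proof (intro equalityI subsetI)
    fix v assume v: "v \<in> B - A"
    then have "v \<notin> vec.span A" using A by (metis DiffD2 vec.span_eq_iff)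
    moreover have "vec.span (insert v A) \<subseteq> B"
      using v AB B by (intro vec.span_minimal) auto
    ultimately have "vec.span (insert v A) \<in> between A B"
      using vec.span_superset[of "insert v A"] by (auto simp: between_def vec.dim_insert)
    with v show "v \<in> (\<Union>C\<in>between A B. C - A)"
      using vec.span_superset[of "insert v A"] by blast
  qed (auto simp: between_def)
  have "card (B - A) = (\<Sum>C\<in>between A B. card (C - A))"
    unfolding cover
  proof (rule card_UN_disjoint)
    show "\<forall>C\<in>between A B. \<forall>D\<in>between A B. C \<noteq> D \<longrightarrow> (C - A) \<inter> (D - A) = {}"
      using span_eq by blast
  qed auto
  also have "\<dots> = (\<Sum>C\<in>between A B. CARD('a) ^ Suc (vec.dim A) - CARD('a) ^ vec.dim A)"
    by (rule sum.cong) (auto simp: between_def card_Diff_subset card_subspace A)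
  finally show ?thesis
    using AB by (simp add: card_Diff_subset card_subspace A B)
qed

lemma card_between:
  fixes A B :: "('a::{field,finite} ^ 'n) set"
  assumes A: "vec.subspace A" and B: "vec.subspace B" and AB: "A \<subseteq> B"
    and dim: "vec.dim B = vec.dim A + m"
  shows "card (between A B) = (\<Sum>i<m. CARD('a) ^ i)"
proof -
  define q where "q = int CARD('a)"
  have "card {0::'a, 1} \<le> CARD('a)" by (intro card_mono) auto
  then have q: "q > 1" by (simp add: q_def)
  have "int (card (between A B)) * (q ^ Suc (vec.dim A) - q ^ vec.dim A) =
    q ^ vec.dim B - q ^ vec.dim A"
    using arg_cong[OF card_between_mult[OF A B AB], of int] q dim
    by (simp add: of_nat_diff q_def power_increasing)
  then have "q ^ vec.dim A * (int (card (between A B)) * (q - 1)) = q ^ vec.dim A * (q ^ m - 1)"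
    by (simp add: dim power_add algebra_simps)
  then have "int (card (between A B)) * (q - 1) = (\<Sum>i<m. q ^ i) * (q - 1)"
    using q by (simp add: power_diff_1_eq mult.commute)
  then have "int (card (between A B)) = (\<Sum>i<m. q ^ i)"
    using q by simp
  then have "int (card (between A B)) = int (\<Sum>i<m. CARD('a) ^ i)"
    by (simp add: q_def)
  then show ?thesis by (simp only: of_nat_eq_iff)
qed

section \<open>Meets and joins in codimension one; local Hecke relations\<close>

text \<open>A meet larger than \<open>C\<close> would have the dimension of \<open>Y\<close> and of
  \<open>Y'\<close> and so equal both; the next lemma is the dual.\<close>

lemma Int_eq_of_codim_1:
  assumes "vec.subspace C" "vec.subspace Y" "vec.subspace Y'" "C \<subseteq> Y" "C \<subseteq> Y'" "Y \<noteq> Y'"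
    and dim: "vec.dim Y = Suc (vec.dim C)" "vec.dim Y' = Suc (vec.dim C)"
  shows "Y \<inter> Y' = C"
proof (rule sym, rule vec.subspace_dim_equal)
  show "vec.dim (Y \<inter> Y') \<le> vec.dim C"
  proof (rule ccontr)
    assume "\<not> ?thesis"
    then have "vec.dim Y \<le> vec.dim (Y \<inter> Y')" "vec.dim Y' \<le> vec.dim (Y \<inter> Y')"
      using dim by auto
    then have "Y \<inter> Y' = Y" "Y \<inter> Y' = Y'"
      using assms(2,3) vec.subspace_inter vec.subspace_dim_equal Int_lower1 Int_lower2 by metis+
    with \<open>Y \<noteq> Y'\<close> show False by blast
  qed
qed (use assms in \<open>auto simp: vec.subspace_inter\<close>)

lemma span_Un_eq_of_codim_1:
  assumes "vec.subspace X" "vec.subspace X'" "vec.subspace D" "X \<subseteq> D" "X' \<subseteq> D" "X \<noteq> X'"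
    and dim: "vec.dim X' = vec.dim X" "vec.dim D = Suc (vec.dim X)"
  shows "vec.span (X \<union> X') = D"
proof (rule vec.subspace_dim_equal)
  show "vec.dim D \<le> vec.dim (vec.span (X \<union> X'))"
  proof (rule ccontr)
    assume *: "\<not> ?thesis"
    have "X \<subseteq> vec.span (X \<union> X')" "X' \<subseteq> vec.span (X \<union> X')"
      using vec.span_superset[of "X \<union> X'"] by auto
    moreover have "vec.dim (vec.span (X \<union> X')) \<le> vec.dim X"
      "vec.dim (vec.span (X \<union> X')) \<le> vec.dim X'"
      using * dim by auto
    ultimately have "X = vec.span (X \<union> X')" "X' = vec.span (X \<union> X')"
      using assms(1,2) vec.subspace_span vec.subspace_dim_equal by metis+
    with \<open>X \<noteq> X'\<close> show False by blast
  qed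
  show "vec.span (X \<union> X') \<subseteq> D"
    using assms by (intro vec.span_minimal) auto
qed (use assms in auto)

text \<open>The quadratic Hecke relation on \<open>q + 1\<close> choices: two successive changes
  return to \<open>x\<close> in \<open>q\<close> ways and reach any other element in
  \<open>q - 1\<close> ways.\<close>

lemma sum_sum_remove:
  fixes g :: "'b \<Rightarrow> int"
  assumes "finite M" "x \<in> M" "int (card M) = q + 1"
  shows "(\<Sum>y\<in>M - {x}. \<Sum>z\<in>M - {y}. g z) = (q - 1) * (\<Sum>y\<in>M - {x}. g y) + q * g x"
proof -
  have "(\<Sum>y\<in>M - {x}. \<Sum>z\<in>M - {y}. g z) = (\<Sum>y\<in>M - {x}. (\<Sum>z\<in>M - {x}. g z) + g x - g y)"
    using assms by (intro sum.cong) (auto simp: sum_diff1)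
  also have "\<dots> = int (card (M - {x})) * ((\<Sum>z\<in>M - {x}. g z) + g x) - (\<Sum>y\<in>M - {x}. g y)"
    by (simp add: sum_subtractf)
  also have "int (card (M - {x})) = q"
    using card_Suc_Diff1[OF assms(1,2)] assms(3) by linarith
  finally show ?thesis by (simp add: algebra_simps)
qed

text \<open>Both sides sum \<open>g\<close> over the pairs \<open>X'' \<subset> Y''\<close> opposite to \<open>X \<subset> Y\<close>: the intermediate
  subspaces are forced to be \<open>Y \<inter> Y''\<close> and \<open>X + X''\<close>, respectively.\<close>
lemma sum_between_braid:
  fixes A B :: "('a::{field,finite} ^ 'n) set" and g :: "_ \<Rightarrow> _ \<Rightarrow> int"
  assumes A: "vec.subspace A" and B: "vec.subspace B" and dim: "vec.dim B = vec.dim A + 3"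
    and X: "X \<in> between A B" and Y: "Y \<in> between X B"
  shows "(\<Sum>X'\<in>between A Y - {X}. \<Sum>Y'\<in>between X' B - {Y}. \<Sum>X''\<in>between A Y' - {X'}. g X'' Y')
       = (\<Sum>Y'\<in>between X B - {Y}. \<Sum>X'\<in>between A Y' - {X}. \<Sum>Y''\<in>between X' B - {Y'}. g X' Y'')"
    (is "?L = ?R")
proof -
  define Opp where "Opp = {(X'', Y''). X'' \<in> between A B \<and> Y'' \<in> between X'' B
    \<and> \<not> X'' \<subseteq> Y \<and> \<not> X \<subseteq> Y''}"
  note bd = between_def
  have XY: "vec.subspace X" "A \<subseteq> X" "X \<subseteq> B" "vec.dim X = Suc (vec.dim A)"
    "vec.subspace Y" "X \<subseteq> Y" "Y \<subseteq> B" "vec.dim Y = Suc (Suc (vec.dim A))"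
    using X Y by (auto simp: bd)
  have "?L = (\<Sum>(X', Y', X'')\<in>(SIGMA X':between A Y - {X}. SIGMA Y':between X' B - {Y}.
      between A Y' - {X'}). g X'' Y')"
    by (simp add: sum.Sigma)
  also have "\<dots> = (\<Sum>(X'', Y'')\<in>Opp. g X'' Y'')"
  proof (rule sum.reindex_bij_witness[where i = "\<lambda>(X'', Y''). (Y \<inter> Y'', Y'', X'')"
        and j = "\<lambda>(X', Y', X''). (X'', Y')"], goal_cases)
    case (1 t)
    then obtain X' Y' X'' where t: "t = (X', Y', X'')" and X': "X' \<in> between A Y" "X' \<noteq> X"
      and Y': "Y' \<in> between X' B" "Y' \<noteq> Y" and X'': "X'' \<in> between A Y'" "X'' \<noteq> X'" by auto
    have "Y \<inter> Y' = X'"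
      using X' Y' XY by (intro Int_eq_of_codim_1) (auto simp: bd)
    then show ?case by (simp add: t)
  next
    case (2 t)
    then obtain X' Y' X'' where t: "t = (X', Y', X'')" and X': "X' \<in> between A Y" "X' \<noteq> X"
      and Y': "Y' \<in> between X' B" "Y' \<noteq> Y" and X'': "X'' \<in> between A Y'" "X'' \<noteq> X'" by auto
    have int: "Y \<inter> Y' = X'"
      using X' Y' XY by (intro Int_eq_of_codim_1) (auto simp: bd)
    have "\<not> X'' \<subseteq> X'" "\<not> X \<subseteq> X'"
      using X' X'' XY vec.subspace_dim_equal[of X'' X'] vec.subspace_dim_equal[of X X']
      by (auto simp: bd)
    with int X' X'' Y' XY show ?case by (auto simp: t Opp_def bd)
  next
    case (3 t)
    then show ?case by (simp split: prod.splits)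
  next
    case (4 t)
    then obtain X'' Y'' where t: "t = (X'', Y'')" and X'': "X'' \<in> between A B"
      and Y'': "Y'' \<in> between X'' B" and opp: "\<not> X'' \<subseteq> Y" "\<not> X \<subseteq> Y''"
      by (auto simp: Opp_def)
    have sub: "vec.subspace (Y \<inter> Y'')"
      using XY Y'' by (auto simp: bd vec.subspace_inter)
    \<comment> \<open>In \<open>B / A\<close>, which has dimension 3, two planes meet in dimension
      at least 1 by the dimension formula.\<close>
    have "vec.span (Y \<union> Y'') \<subseteq> B"
      using XY Y'' B by (intro vec.span_minimal) (auto simp: bd)
    then have "vec.dim (vec.span (Y \<union> Y'')) \<le> vec.dim B"
      by (rule vec.dim_subset)
    then have "vec.dim (Y \<inter> Y'') \<ge> Suc (vec.dim A)"
      using dim_span_Un[of Y Y''] XY Y'' X'' dim by (auto simp: bd)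
    moreover have "\<not> vec.dim (Y \<inter> Y'') \<ge> vec.dim Y"
      using vec.subspace_dim_equal[of "Y \<inter> Y''" Y] sub XY opp by auto
    ultimately have "vec.dim (Y \<inter> Y'') = Suc (vec.dim A)"
      using XY by simp
    with sub X'' Y'' XY opp show ?case by (auto simp: t bd)
  next
    case (5 t)
    then show ?case by (auto simp: Opp_def)
  qed
  also have "\<dots> = (\<Sum>(Y', X', Y'')\<in>(SIGMA Y':between X B - {Y}. SIGMA X':between A Y' - {X}.
      between X' B - {Y'}). g X' Y'')"
  proof (rule sum.reindex_bij_witness[where j = "\<lambda>(X'', Y''). (vec.span (X \<union> X''), X'', Y'')"
        and i = "\<lambda>(Y', X', Y''). (X', Y'')"], goal_cases)
    case (1 t)
    then show ?case by (simp split: prod.splits)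
  next
    case (2 t)
    then obtain X'' Y'' where t: "t = (X'', Y'')" and X'': "X'' \<in> between A B"
      and Y'': "Y'' \<in> between X'' B" and opp: "\<not> X'' \<subseteq> Y" "\<not> X \<subseteq> Y''"
      by (auto simp: Opp_def)
    let ?J = "vec.span (X \<union> X'')"
    have J: "X \<subseteq> ?J" "X'' \<subseteq> ?J" "?J \<subseteq> B" "vec.subspace ?J"
      using vec.span_superset[of "X \<union> X''"] XY X'' B vec.span_minimal[of "X \<union> X''" B]
      by (auto simp: bd)
    have "A \<subseteq> X \<inter> X''" using X'' XY by (auto simp: bd)
    then have "vec.dim (X \<inter> X'') \<ge> vec.dim A"
      by (rule vec.dim_subset)
    moreover have "X \<inter> X'' \<noteq> X" and X''_sub: "vec.subspace X''" "vec.dim X'' = Suc (vec.dim A)"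
      using X'' Y'' opp by (auto simp: bd)
    then have "\<not> vec.dim (X \<inter> X'') \<ge> vec.dim X"
      using vec.subspace_dim_equal[of "X \<inter> X''" X] XY(1) vec.subspace_inter by blast
    ultimately have "vec.dim ?J = Suc (vec.dim X)"
      using dim_span_Un[OF XY(1) X''_sub(1)] XY(4) X''_sub(2) by linarith
    then show ?case
      using J X'' Y'' XY opp by (auto simp: t bd)
  next
    case (3 t)
    then obtain Y' X' Y'' where t: "t = (Y', X', Y'')" and Y': "Y' \<in> between X B" "Y' \<noteq> Y"
      and X': "X' \<in> between A Y'" "X' \<noteq> X" and Y'': "Y'' \<in> between X' B" "Y'' \<noteq> Y'" by auto
    have "vec.span (X \<union> X') = Y'"
      using X' Y' XY by (intro span_Un_eq_of_codim_1) (auto simp: bd)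
    then show ?case by (simp add: t)
  next
    case (4 t)
    then obtain Y' X' Y'' where t: "t = (Y', X', Y'')" and Y': "Y' \<in> between X B" "Y' \<noteq> Y"
      and X': "X' \<in> between A Y'" "X' \<noteq> X" and Y'': "Y'' \<in> between X' B" "Y'' \<noteq> Y'" by auto
    have span: "vec.span (X \<union> X') = Y'"
      using X' Y' XY by (intro span_Un_eq_of_codim_1) (auto simp: bd)
    have "\<not> Y' \<subseteq> Y" "\<not> Y' \<subseteq> Y''"
      using X' Y' Y'' XY vec.subspace_dim_equal[of Y' Y] vec.subspace_dim_equal[of Y' Y'']
      by (auto simp: bd)
    then have "\<not> X' \<subseteq> Y" "\<not> X \<subseteq> Y''"
      using vec.span_minimal[of "X \<union> X'" Y] vec.span_minimal[of "X \<union> X'" Y''] span XY Y''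
      by (auto simp: bd)
    with X' Y' Y'' show ?case by (auto simp: t Opp_def bd)
  next
    case (5 t)
    then show ?case by (auto simp: Opp_def)
  qed
  also have "\<dots> = ?R"
    by (simp add: sum.Sigma)
  finally show ?thesis .
qed

section \<open>The Hecke algebra of \<open>S\<^sub>4\<close>\<close>

text \<open>A polynomial in \<open>q\<close> is the list of its coefficients, constant term first, and an element of
  the Hecke algebra of \<open>S\<^sub>4\<close> is the list of its 24 coordinates in the standard basis, ordered as in
  \<open>basis\<close> below. In this form its multiplication can be executed by the simplifier.\<close>

fun padd :: "int list \<Rightarrow> int list \<Rightarrow> int list" (infixl \<open>\<oplus>\<close> 65) where
  "[] \<oplus> ys = ys"
| "xs \<oplus> [] = xs"
| "(x # xs) \<oplus> (y # ys) = (x + y) # (xs \<oplus> ys)"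

definition times_q_minus_1 :: "int list \<Rightarrow> int list" where
  "times_q_minus_1 xs = (0 # xs) \<oplus> map uminus xs"

primrec pmul :: "int list \<Rightarrow> int list \<Rightarrow> int list" (infixl \<open>\<odot>\<close> 70) where
  "[] \<odot> ys = []"
| "(x # xs) \<odot> ys = map ((*) x) ys \<oplus> (0 # (xs \<odot> ys))"

text \<open>A generator \<open>s\<close> maps \<open>w\<close> to \<open>s w\<close> if that is
  longer, and maps this \<open>s w\<close> to \<open>q\<close> times \<open>w\<close> plus
  \<open>q - 1\<close> times \<open>s w\<close>. Prefixing \<open>0\<close> multiplies by
  \<open>q\<close>. The pairs in \<open>mul_X\<close>, \<open>mul_Y\<close> and \<open>mul_Z\<close>
  follow the order of \<open>basis\<close>.\<close>

definition mul_X :: "int list list \<Rightarrow> int list list" where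
  "mul_X c = [
     0 # c ! 1, c ! 0 \<oplus> times_q_minus_1 (c ! 1), 0 # c ! 3, c ! 2 \<oplus> times_q_minus_1 (c ! 3),
     0 # c ! 5, c ! 4 \<oplus> times_q_minus_1 (c ! 5), 0 # c ! 7, c ! 6 \<oplus> times_q_minus_1 (c ! 7),
     0 # c ! 9, c ! 8 \<oplus> times_q_minus_1 (c ! 9), 0 # c ! 11, c ! 10 \<oplus> times_q_minus_1 (c ! 11),
     0 # c ! 13, c ! 12 \<oplus> times_q_minus_1 (c ! 13), 0 # c ! 15, c ! 14 \<oplus> times_q_minus_1 (c ! 15),
     0 # c ! 17, c ! 16 \<oplus> times_q_minus_1 (c ! 17), 0 # c ! 19, c ! 18 \<oplus> times_q_minus_1 (c ! 19),
     0 # c ! 21, c ! 20 \<oplus> times_q_minus_1 (c ! 21), 0 # c ! 23, c ! 22 \<oplus> times_q_minus_1 (c ! 23)]"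

definition mul_Y :: "int list list \<Rightarrow> int list list" where
  "mul_Y c = [
     0 # c ! 2, 0 # c ! 4, c ! 0 \<oplus> times_q_minus_1 (c ! 2), 0 # c ! 5,
     c ! 1 \<oplus> times_q_minus_1 (c ! 4), c ! 3 \<oplus> times_q_minus_1 (c ! 5), 0 # c ! 8, 0 # c ! 10,
     c ! 6 \<oplus> times_q_minus_1 (c ! 8), 0 # c ! 11, c ! 7 \<oplus> times_q_minus_1 (c ! 10), c ! 9 \<oplus> times_q_minus_1 (c ! 11),
     0 # c ! 14, 0 # c ! 16, c ! 12 \<oplus> times_q_minus_1 (c ! 14), 0 # c ! 17,
     c ! 13 \<oplus> times_q_minus_1 (c ! 16), c ! 15 \<oplus> times_q_minus_1 (c ! 17), 0 # c ! 20, 0 # c ! 22,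
     c ! 18 \<oplus> times_q_minus_1 (c ! 20), 0 # c ! 23, c ! 19 \<oplus> times_q_minus_1 (c ! 22), c ! 21 \<oplus> times_q_minus_1 (c ! 23)]"

definition mul_Z :: "int list list \<Rightarrow> int list list" where
  "mul_Z c = [
     0 # c ! 6, 0 # c ! 7, 0 # c ! 12, 0 # c ! 13,
     0 # c ! 18, 0 # c ! 19, c ! 0 \<oplus> times_q_minus_1 (c ! 6), c ! 1 \<oplus> times_q_minus_1 (c ! 7),
     0 # c ! 14, 0 # c ! 15, 0 # c ! 20, 0 # c ! 21,
     c ! 2 \<oplus> times_q_minus_1 (c ! 12), c ! 3 \<oplus> times_q_minus_1 (c ! 13), c ! 8 \<oplus> times_q_minus_1 (c ! 14), c ! 9 \<oplus> times_q_minus_1 (c ! 15),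
     0 # c ! 22, 0 # c ! 23, c ! 4 \<oplus> times_q_minus_1 (c ! 18), c ! 5 \<oplus> times_q_minus_1 (c ! 19),
     c ! 10 \<oplus> times_q_minus_1 (c ! 20), c ! 11 \<oplus> times_q_minus_1 (c ! 21), c ! 16 \<oplus> times_q_minus_1 (c ! 22), c ! 17 \<oplus> times_q_minus_1 (c ! 23)]"

definition mul_T :: "int list list \<Rightarrow> int list list" where
  "mul_T c = mul_X (mul_Y (mul_Z c))"

definition one_coeffs :: "int list list" where
  "one_coeffs = [1] # replicate 23 []"

text \<open>Coefficients of the minimal polynomial
  \<open>(t - q\<^sup>3) (t\<^sup>3 + q\<^sup>2 t\<^sup>2 + q\<^sup>4 t + q\<^sup>6) (t\<^sup>2 - q\<^sup>3) (t\<^sup>3 - q t\<^sup>2 + q\<^sup>2 t - q\<^sup>3) (t + 1)\<close> of the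
  Coxeter element; the factors come from the five irreducible representations.\<close>
definition minimal_coeffs :: "int list list" where
  "minimal_coeffs = [
     [0, 0, 0, 0, 0, 0, 0, 0, 0, 0, 0, 0, 0, 0, 0, -1],
     [0, 0, 0, 0, 0, 0, 0, 0, 0, 0, 0, 0, 1, -1, 1, -1],
     [0, 0, 0, 0, 0, 0, 0, 0, 0, 0, 1, -2, 3, -2, 1],
     [0, 0, 0, 0, 0, 0, 0, 0, 1, -3, 4, -4, 3, -1],
     [0, 0, 0, 0, 0, 0, 1, -2, 5, -6, 5, -2, 1],
     [0, 0, 0, 0, 0, -2, 4, -6, 6, -4, 2],
     [0, 0, 0, -1, 2, -5, 6, -5, 2, -1],
     [0, 0, 1, -3, 4, -4, 3, -1],
     [0, -1, 2, -3, 2, -1],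
     [1, -1, 1, -1],
     [1]]"

primrec iterates :: "('a \<Rightarrow> 'a) \<Rightarrow> nat \<Rightarrow> 'a \<Rightarrow> 'a list" where
  "iterates f 0 x = []"
| "iterates f (Suc n) x = x # iterates f n (f x)"

primrec peval :: "int \<Rightarrow> int list \<Rightarrow> int" where
  "peval q [] = 0"
| "peval q (x # xs) = x + q * peval q xs"

lemma length_iterates [simp]: "length (iterates f n x) = n"
  by (induction n arbitrary: x) auto

lemma iterates_nth: "k < n \<Longrightarrow> iterates f n x ! k = (f ^^ k) x"
  by (induction n arbitrary: x k) (auto simp: nth_Cons funpow_swap1 split: nat.split)

text \<open>Symbolic check, with \<open>q\<close> indeterminate, that the polynomial kills the
  Coxeter element in each coordinate. Zero is any list of zeros, as sums are not trimmed.\<close>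

lemma minimal_coeffs_annihilate_aux:
  "let hs = iterates mul_T 11 one_coeffs in
     list_all (\<lambda>i. list_all (\<lambda>a. a = 0)
       (foldr padd (map (\<lambda>k. minimal_coeffs ! k \<odot> hs ! k ! i) [0..<11]) [])) [0..<24]"
  by code_simp

text \<open>The identity coordinates of the first ten powers are the initial data of the recurrence.
  Trailing zeros come from untrimmed arithmetic.\<close>

lemma unit_coefficients:
  "map (\<lambda>c. c ! 0) (iterates mul_T 10 one_coeffs) = [
     [1],
     [0, 0, 0],
     [0, 0, 0, 0, 0, 0],
     [0, 0, 0, 0, 0, 0, 0, 0, 0],
     [0, 0, 0, 0, 0, 0, 1, 0, 0, 0, 0, 0],
     [0, 0, 0, 0, 0, 0, -1, 3, -3, 1, 0, 0, 0, 0, 0],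
     [0, 0, 0, 0, 0, 0, 1, -3, 4, -4, 4, -3, 1, 0, 0, 0, 0, 0],
     [0, 0, 0, 0, 0, 0, -1, 3, -4, 3, -1, 1, -3, 4, -3, 1, 0, 0, 0, 0, 0],
     [0, 0, 0, 0, 0, 0, 1, -3, 4, -3, 2, 0, -1, 0, 2, -3, 4, -3, 1, 0, 0, 0, 0, 0],
     [0, 0, 0, 0, 0, 0, -1, 3, -4, 3, -2, 3, -4, 4, -4, 4, -3, 2, -3, 4, -3, 1, 0, 0, 0, 0, 0]]"
  by code_simp

section \<open>Evaluation of coefficient lists at an integer\<close>

lemma peval_padd [simp]:
  "peval q (xs \<oplus> ys) = peval q xs + peval q ys"
  by (induction xs ys rule: padd.induct) (auto simp: algebra_simps)

lemma peval_map_uminus [simp]: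
  "peval q (map uminus xs) = - peval q xs"
  by (induction xs) auto

lemma peval_map_times [simp]:
  "peval q (map ((*) a) xs) = a * peval q xs"
  by (induction xs) (auto simp: algebra_simps)

lemma peval_times_q_minus_1 [simp]: "peval q (times_q_minus_1 xs) = (q - 1) * peval q xs"
  by (simp add: times_q_minus_1_def algebra_simps)

lemma peval_pmul [simp]:
  "peval q (xs \<odot> ys) = peval q xs * peval q ys"
  by (induction xs) (auto simp: algebra_simps)

lemma peval_foldr_padd:
  "peval q (foldr padd (map p ks) []) = (\<Sum>k\<leftarrow>ks. peval q (p k))"
  by (induction ks) auto

lemma peval_zeros: "list_all (\<lambda>a. a = 0) xs \<Longrightarrow> peval q xs = 0"
  by (induction xs) auto

lemma minimal_coeffs_annihilate:
  assumes "i < 24"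
  shows "(\<Sum>k<11. peval q (minimal_coeffs ! k)
           * peval q ((mul_T ^^ k) one_coeffs ! i)) = 0"
proof -
  let ?hs = "iterates mul_T 11 one_coeffs"
  have "list_all (\<lambda>a. a = 0)
      (foldr padd (map (\<lambda>k. minimal_coeffs ! k \<odot> ?hs ! k ! i) [0..<11]) [])"
    using minimal_coeffs_annihilate_aux assms by (simp add: Let_def list_all_iff del: upt_Suc)
  from peval_zeros[OF this, of q]
  have "(\<Sum>k\<leftarrow>[0..<11]. peval q (minimal_coeffs ! k) * peval q (?hs ! k ! i)) = 0"
    by (simp add: peval_foldr_padd del: upt_Suc foldr_map map_upt_Suc)
  then show ?thesis
    by (simp add: interv_sum_list_conv_sum_set_nat atLeast0LessThan iterates_nth del: upt_Suc)
qed

section \<open>Representations of the Hecke algebra on integer functions\<close>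

text \<open>\<open>X\<close>, \<open>Y\<close>, \<open>Z\<close> represent the three generators. The
  relations are oriented so that, together with \<open>ZYXZ\<close>, rewriting leads to the normal
  form of \<open>basis\<close>.\<close>

locale hecke_A3 =
  fixes q :: int and X Y Z :: "('f \<Rightarrow> int) \<Rightarrow> 'f \<Rightarrow> int"
  assumes X_add: "X (\<lambda>F. g F + h F) = (\<lambda>F. X g F + X h F)"
    and Y_add: "Y (\<lambda>F. g F + h F) = (\<lambda>F. Y g F + Y h F)"
    and Z_add: "Z (\<lambda>F. g F + h F) = (\<lambda>F. Z g F + Z h F)"
    and X_scale: "X (\<lambda>F. a * g F) = (\<lambda>F. a * X g F)"
    and Y_scale: "Y (\<lambda>F. a * g F) = (\<lambda>F. a * Y g F)"
    and Z_scale: "Z (\<lambda>F. a * g F) = (\<lambda>F. a * Z g F)"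
    and X_quadratic: "X (X g) = (\<lambda>F. (q - 1) * X g F + q * g F)"
    and Y_quadratic: "Y (Y g) = (\<lambda>F. (q - 1) * Y g F + q * g F)"
    and Z_quadratic: "Z (Z g) = (\<lambda>F. (q - 1) * Z g F + q * g F)"
    and YXY: "Y (X (Y g)) = X (Y (X g))"
    and ZYZ: "Z (Y (Z g)) = Y (Z (Y g))"
    and ZX: "Z (X g) = X (Z g)"
begin

definition basis_S3 :: "('f \<Rightarrow> int) \<Rightarrow> ('f \<Rightarrow> int) list" where
  "basis_S3 g = [g, X g, Y g, X (Y g), Y (X g), X (Y (X g))]"

text \<open>The reduced words are taken in the normal form \<open>{1, x} {1, y, yx} {1, z, zy, zyx}\<close>.\<close>
definition basis :: "('f \<Rightarrow> int) \<Rightarrow> ('f \<Rightarrow> int) list" where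
  "basis g = basis_S3 g @ basis_S3 (Z g) @ basis_S3 (Z (Y g)) @ basis_S3 (Z (Y (X g)))"

definition comb :: "int list list \<Rightarrow> ('f \<Rightarrow> int) \<Rightarrow> 'f \<Rightarrow> int" where
  "comb c g F = (\<Sum>i<24. peval q (c ! i) * (basis g ! i) F)"

definition T :: "('f \<Rightarrow> int) \<Rightarrow> 'f \<Rightarrow> int" where
  "T g = X (Y (Z g))"

text \<open>The overlap of \<open>ZX\<close> and \<open>ZYZ\<close>: the first rule turns the word
  \<open>ZYZX\<close> into \<open>ZYXZ\<close>, so this reduct needs a rule of its own.\<close>

lemma ZYXZ: "Z (Y (X (Z g))) = Y (Z (Y (X g)))"
  by (simp flip: ZX add: ZYZ)

lemmas hecke_rules = X_add Y_add Z_add X_scale Y_scale Z_scale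
  X_quadratic Y_quadratic Z_quadratic YXY ZYZ ZX ZYXZ

lemma comb_expand:
  "comb c g = (\<lambda>F. peval q (c ! 0) * g F +
     peval q (c ! 1) * X g F +
     peval q (c ! 2) * Y g F +
     peval q (c ! 3) * X (Y g) F +
     peval q (c ! 4) * Y (X g) F +
     peval q (c ! 5) * X (Y (X g)) F +
     peval q (c ! 6) * Z g F +
     peval q (c ! 7) * X (Z g) F +
     peval q (c ! 8) * Y (Z g) F +
     peval q (c ! 9) * X (Y (Z g)) F +
     peval q (c ! 10) * Y (X (Z g)) F +
     peval q (c ! 11) * X (Y (X (Z g))) F +
     peval q (c ! 12) * Z (Y g) F +
     peval q (c ! 13) * X (Z (Y g)) F +
     peval q (c ! 14) * Y (Z (Y g)) F +
     peval q (c ! 15) * X (Y (Z (Y g))) F +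
     peval q (c ! 16) * Y (X (Z (Y g))) F +
     peval q (c ! 17) * X (Y (X (Z (Y g)))) F +
     peval q (c ! 18) * Z (Y (X g)) F +
     peval q (c ! 19) * X (Z (Y (X g))) F +
     peval q (c ! 20) * Y (Z (Y (X g))) F +
     peval q (c ! 21) * X (Y (Z (Y (X g)))) F +
     peval q (c ! 22) * Y (X (Z (Y (X g)))) F +
     peval q (c ! 23) * X (Y (X (Z (Y (X g))))) F)"
  by (rule ext) (simp add: comb_def eval_nat_numeral basis_def basis_S3_def)

text \<open>Once the operator is pushed through the 24 terms and each word is normalised, comparing
  coefficients gives \<open>mul_X\<close>; likewise for \<open>Y\<close> and
  \<open>Z\<close>.\<close>

lemma X_comb: "X (comb c g) = comb (mul_X c) g"
  unfolding comb_expand hecke_rules mul_X_def by (rule ext) (simp add: algebra_simps)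

lemma Y_comb: "Y (comb c g) = comb (mul_Y c) g"
  unfolding comb_expand hecke_rules mul_Y_def by (rule ext) (simp add: algebra_simps)

lemma Z_comb: "Z (comb c g) = comb (mul_Z c) g"
  unfolding comb_expand hecke_rules mul_Z_def by (rule ext) (simp add: algebra_simps)

lemma funpow_T: "(T ^^ k) g = comb ((mul_T ^^ k) one_coeffs) g"
proof (induction k)
  case 0
  show ?case by (simp add: comb_expand one_coeffs_def)
next
  case (Suc k)
  then show ?case by (simp add: T_def mul_T_def X_comb Y_comb Z_comb)
qed

text \<open>Starting from \<open>(T ^^ n) g\<close> turns the annihilating polynomial into a
  recurrence at every \<open>n\<close>; the sum vanishes coordinate by coordinate.\<close>

lemma T_recurrence:
  "(\<Sum>k<11. peval q (minimal_coeffs ! k) * (T ^^ (n + k)) g F) = 0"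
proof -
  let ?m = "\<lambda>k. peval q (minimal_coeffs ! k)"
  let ?h = "\<lambda>k i. peval q ((mul_T ^^ k) one_coeffs ! i)"
  have "(\<Sum>k<11. ?m k * (T ^^ (n + k)) g F) =
      (\<Sum>k<11. \<Sum>i<24. ?m k * ?h k i * (basis ((T ^^ n) g) ! i) F)"
    by (simp add: add.commute[of n] funpow_add funpow_T[of _ "(T ^^ n) g"] comb_def sum_distrib_left mult.assoc)
  also have "\<dots> = (\<Sum>i<24. (\<Sum>k<11. ?m k * ?h k i) * (basis ((T ^^ n) g) ! i) F)"
    by (subst sum.swap) (simp add: sum_distrib_right)
  also have "\<dots> = 0"
    by (rule sum.neutral) (simp add: minimal_coeffs_annihilate)
  finally show ?thesis .
qed

end

section \<open>Complete flags\<close>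

type_synonym 'a flag = "('a ^ 4) set \<times> ('a ^ 4) set \<times> ('a ^ 4) set"

definition flags :: "'a::{field,finite} flag set" where
  "flags = (SIGMA P:between {0} UNIV. SIGMA L:between P UNIV. between L UNIV)"

declare card_cart_basis [simp]

lemma flags_iff:
  "(P, L, E) \<in> flags \<longleftrightarrow> vec.subspace P \<and> vec.subspace L \<and> vec.subspace E \<and>
     P \<subseteq> L \<and> L \<subseteq> E \<and> vec.dim P = 1 \<and> vec.dim L = 2 \<and> vec.dim E = 3"
  by (auto simp: flags_def between_def vec.subspace_0)

text \<open>The quotients in which the successive components are chosen have dimensions 4, 3 and 2,
  so the count is the \<open>q\<close>-analogue of 4 factorial.\<close>

lemma card_flags:
  "card (flags :: 'a::{field,finite} flag set) =
     (\<Sum>i<4. CARD('a) ^ i) * (\<Sum>i<3. CARD('a) ^ i) * (\<Sum>i<2. CARD('a) ^ i)"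
proof -
  have E: "card (between L UNIV) = (\<Sum>i<2. CARD('a) ^ i)"
    if "L \<in> between P UNIV" "P \<in> between {0} UNIV" for L P :: "('a ^ 4) set"
    using that by (intro card_between) (auto simp: between_def)
  have L: "card (between P UNIV) = (\<Sum>i<3. CARD('a) ^ i)"
    if "P \<in> between {0} UNIV" for P :: "('a ^ 4) set"
    using that by (intro card_between) (auto simp: between_def)
  have P: "card (between {0} (UNIV :: ('a ^ 4) set)) = (\<Sum>i<4. CARD('a) ^ i)"
    by (intro card_between) (auto simp: vec.subspace_0 vec.subspace_single_0)
  have "card (flags :: 'a flag set) = (\<Sum>P\<in>between {0} (UNIV :: ('a ^ 4) set).
      \<Sum>L\<in>between P UNIV. card (between L UNIV))"
    by (simp add: flags_def)
  also have "\<dots> = (\<Sum>P\<in>between {0} (UNIV :: ('a ^ 4) set).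
      (\<Sum>i<3. CARD('a) ^ i) * (\<Sum>i<2. CARD('a) ^ i))"
    by (intro sum.cong refl) (simp add: E L)
  finally show ?thesis by (simp add: P mult.assoc)
qed

text \<open>Off the set of flags the operators are multiplication by \<open>q\<close>, the trivial
  representation, so that the Hecke relations hold unconditionally.\<close>

fun move_P :: "('a::{field,finite} flag \<Rightarrow> int) \<Rightarrow> 'a flag \<Rightarrow> int" where
  "move_P g (P, L, E) = (if (P, L, E) \<in> flags then \<Sum>P'\<in>between {0} L - {P}. g (P', L, E)
     else int CARD('a) * g (P, L, E))"

fun move_L :: "('a::{field,finite} flag \<Rightarrow> int) \<Rightarrow> 'a flag \<Rightarrow> int" where
  "move_L g (P, L, E) = (if (P, L, E) \<in> flags then \<Sum>L'\<in>between P E - {L}. g (P, L', E)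
     else int CARD('a) * g (P, L, E))"

fun move_E :: "('a::{field,finite} flag \<Rightarrow> int) \<Rightarrow> 'a flag \<Rightarrow> int" where
  "move_E g (P, L, E) = (if (P, L, E) \<in> flags then \<Sum>E'\<in>between L UNIV - {E}. g (P, L, E')
     else int CARD('a) * g (P, L, E))"

lemma flag_move:
  assumes "(P, L, E) \<in> flags"
  shows "P' \<in> between {0} L \<Longrightarrow> (P', L, E) \<in> flags"
    and "L' \<in> between P E \<Longrightarrow> (P, L', E) \<in> flags"
    and "E' \<in> between L UNIV \<Longrightarrow> (P, L, E') \<in> flags"
  using assms by (auto simp: flags_iff between_def)

lemma flag_between:
  assumes "(P, L, E) \<in> flags"
  shows "P \<in> between {0} L" "L \<in> between P E" "E \<in> between L UNIV"
  using assms by (auto simp: flags_iff between_def vec.subspace_0)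

section \<open>Hecke relations for the flag operators\<close>

lemma int_card_between_2:
  fixes A B :: "('a::{field,finite} ^ 'n) set"
  assumes "vec.subspace A" "vec.subspace B" "A \<subseteq> B" "vec.dim B = vec.dim A + 2"
  shows "int (card (between A B)) = int CARD('a) + 1"
  by (simp add: card_between[OF assms] numeral_2_eq_2)

text \<open>The quadratic relations are \<open>sum_sum_remove\<close> on the \<open>q + 1\<close>
  choices for one component. The braid relations take place between \<open>{0}\<close> and
  \<open>E\<close>, and between \<open>P\<close> and \<open>UNIV\<close>, both of relative dimension
  3.\<close>

interpretation flag: hecke_A3 "int CARD('a::{field,finite})"
  "move_P :: ('a flag \<Rightarrow> int) \<Rightarrow> 'a flag \<Rightarrow> int" move_L move_E
proof
  fix g h :: "'a flag \<Rightarrow> int" and a :: int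
  let ?q = "int CARD('a)"
  show "move_P (\<lambda>F. g F + h F) = (\<lambda>F. move_P g F + move_P h F)"
    "move_L (\<lambda>F. g F + h F) = (\<lambda>F. move_L g F + move_L h F)"
    "move_E (\<lambda>F. g F + h F) = (\<lambda>F. move_E g F + move_E h F)"
    by (auto simp: fun_eq_iff sum.distrib algebra_simps)
  show "move_P (\<lambda>F. a * g F) = (\<lambda>F. a * move_P g F)"
    "move_L (\<lambda>F. a * g F) = (\<lambda>F. a * move_L g F)"
    "move_E (\<lambda>F. a * g F) = (\<lambda>F. a * move_E g F)"
    by (auto simp: fun_eq_iff sum_distrib_left)
  show "move_P (move_P g) = (\<lambda>F. (?q - 1) * move_P g F + ?q * g F)"
  proof (intro ext, clarify)
    fix P L E
    show "move_P (move_P g) (P, L, E) = (?q - 1) * move_P g (P, L, E) + ?q * g (P, L, E)"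
    proof (cases "(P, L, E) \<in> flags")
      case F: True
      have "(\<Sum>P'\<in>between {0} L - {P}. \<Sum>P''\<in>between {0} L - {P'}. g (P'', L, E)) =
          (?q - 1) * (\<Sum>P'\<in>between {0} L - {P}. g (P', L, E)) + ?q * g (P, L, E)"
        using F flag_between(1)[OF F] by (intro sum_sum_remove int_card_between_2)
          (auto simp: flags_iff vec.subspace_0 vec.subspace_single_0)
      then show ?thesis
        using F flag_move(1)[OF F] by simp
    next
      case False
      then show ?thesis by (simp add: algebra_simps)
    qed
  qed
  show "move_L (move_L g) = (\<lambda>F. (?q - 1) * move_L g F + ?q * g F)"
  proof (intro ext, clarify)
    fix P L E
    show "move_L (move_L g) (P, L, E) = (?q - 1) * move_L g (P, L, E) + ?q * g (P, L, E)"
    proof (cases "(P, L, E) \<in> flags")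
      case F: True
      have "(\<Sum>L'\<in>between P E - {L}. \<Sum>L''\<in>between P E - {L'}. g (P, L'', E)) =
          (?q - 1) * (\<Sum>L'\<in>between P E - {L}. g (P, L', E)) + ?q * g (P, L, E)"
        using F flag_between(2)[OF F] by (intro sum_sum_remove int_card_between_2)
          (auto simp: flags_iff)
      then show ?thesis
        using F flag_move(2)[OF F] by simp
    next
      case False
      then show ?thesis by (simp add: algebra_simps)
    qed
  qed
  show "move_E (move_E g) = (\<lambda>F. (?q - 1) * move_E g F + ?q * g F)"
  proof (intro ext, clarify)
    fix P L E
    show "move_E (move_E g) (P, L, E) = (?q - 1) * move_E g (P, L, E) + ?q * g (P, L, E)"
    proof (cases "(P, L, E) \<in> flags")
      case F: True
      have "(\<Sum>E'\<in>between L UNIV - {E}. \<Sum>E''\<in>between L UNIV - {E'}. g (P, L, E'')) =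
          (?q - 1) * (\<Sum>E'\<in>between L UNIV - {E}. g (P, L, E')) + ?q * g (P, L, E)"
        using F flag_between(3)[OF F] by (intro sum_sum_remove int_card_between_2)
          (auto simp: flags_iff)
      then show ?thesis
        using F flag_move(3)[OF F] by simp
    next
      case False
      then show ?thesis by (simp add: algebra_simps)
    qed
  qed
  show "move_L (move_P (move_L g)) = move_P (move_L (move_P g))"
  proof (intro ext, clarify)
    fix P L E
    show "move_L (move_P (move_L g)) (P, L, E) = move_P (move_L (move_P g)) (P, L, E)"
    proof (cases "(P, L, E) \<in> flags")
      case F: True
      have "(\<Sum>P'\<in>between {0} L - {P}. \<Sum>L'\<in>between P' E - {L}. \<Sum>P''\<in>between {0} L' - {P'}. g (P'', L', E))
         = (\<Sum>L'\<in>between P E - {L}. \<Sum>P'\<in>between {0} L' - {P}. \<Sum>L''\<in>between P' E - {L'}. g (P', L'', E))"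
        using F by (intro sum_between_braid[where g = "\<lambda>P L. g (P, L, E)"])
          (auto simp: flags_iff between_def vec.subspace_0 vec.subspace_single_0)
      moreover have "(P', L, E) \<in> flags" if "P' \<in> between {0} L" for P'
        using F that by (auto simp: flags_iff between_def)
      moreover have "(P, L', E) \<in> flags" if "L' \<in> between P E" for L'
        using F that by (auto simp: flags_iff between_def)
      moreover have "(P', L', E) \<in> flags" if "P' \<in> between {0} L" "L' \<in> between P' E" for P' L'
        using F that by (auto simp: flags_iff between_def)
      moreover have "(P', L', E) \<in> flags" if "L' \<in> between P E" "P' \<in> between {0} L'" for P' L'
        using F that by (auto simp: flags_iff between_def)
      ultimately show ?thesis
        using F by simp
    qed simp
  qed
  show "move_E (move_L (move_E g)) = move_L (move_E (move_L g))"
  proof (intro ext, clarify)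
    fix P L E
    show "move_E (move_L (move_E g)) (P, L, E) = move_L (move_E (move_L g)) (P, L, E)"
    proof (cases "(P, L, E) \<in> flags")
      case F: True
      have "(\<Sum>L'\<in>between P E - {L}. \<Sum>E'\<in>between L' UNIV - {E}. \<Sum>L''\<in>between P E' - {L'}. g (P, L'', E'))
         = (\<Sum>E'\<in>between L UNIV - {E}. \<Sum>L'\<in>between P E' - {L}. \<Sum>E''\<in>between L' UNIV - {E'}. g (P, L', E''))"
        using F by (intro sum_between_braid[where g = "\<lambda>L E. g (P, L, E)"])
          (auto simp: flags_iff between_def)
      moreover have "(P, L', E) \<in> flags" if "L' \<in> between P E" for L'
        using F that by (auto simp: flags_iff between_def)
      moreover have "(P, L, E') \<in> flags" if "E' \<in> between L UNIV" for E'
        using F that by (auto simp: flags_iff between_def)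
      moreover have "(P, L', E') \<in> flags" if "L' \<in> between P E" "E' \<in> between L' UNIV" for L' E'
        using F that by (auto simp: flags_iff between_def)
      moreover have "(P, L', E') \<in> flags" if "E' \<in> between L UNIV" "L' \<in> between P E'" for L' E'
        using F that by (auto simp: flags_iff between_def)
      ultimately show ?thesis
        using F by simp
    qed simp
  qed
  show "move_E (move_P g) = move_P (move_E g)"
  proof (intro ext, clarify)
    fix P L E
    show "move_E (move_P g) (P, L, E) = move_P (move_E g) (P, L, E)"
    proof (cases "(P, L, E) \<in> flags")
      case F: True
      \<comment> \<open>The ranges of the new point and the new plane depend on \<open>L\<close>
        only, so the two sums can be interchanged.\<close>
      show ?thesis
        using F flag_move[OF F] by (simp, subst sum.swap) simp
    qed simp
  qed
qed

section \<open>Diagonal entries of words in the flag operators\<close>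

text \<open>\<open>\<pi>\<close> picks a component. Starting from the indicator of a flag,
  \<open>supported_on\<close> records that this component has not been moved yet,
  \<open>vanishes_on\<close> that it has been moved once.\<close>

definition supported_on :: "('a::{field,finite} flag \<Rightarrow> 'b) \<Rightarrow> 'b \<Rightarrow> ('a flag \<Rightarrow> int) \<Rightarrow> bool" where
  "supported_on \<pi> c g \<longleftrightarrow> (\<forall>F\<in>flags. \<pi> F \<noteq> c \<longrightarrow> g F = 0)"

definition vanishes_on :: "('a::{field,finite} flag \<Rightarrow> 'b) \<Rightarrow> 'b \<Rightarrow> ('a flag \<Rightarrow> int) \<Rightarrow> bool" where
  "vanishes_on \<pi> c g \<longleftrightarrow> (\<forall>F\<in>flags. \<pi> F = c \<longrightarrow> g F = 0)"

abbreviation "the_P \<equiv> \<lambda>(P, L, E). P"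
abbreviation "the_L \<equiv> \<lambda>(P, L, E). L"
abbreviation "the_E \<equiv> \<lambda>(P, L, E). E"

lemma supported_on_move:
  "supported_on the_L L g \<Longrightarrow> supported_on the_L L (move_P g)"
  "supported_on the_E E g \<Longrightarrow> supported_on the_E E (move_P g)"
  "supported_on the_E E g \<Longrightarrow> supported_on the_E E (move_L g)"
  by (auto simp: supported_on_def Ball_def flags_iff between_def intro!: sum.neutral)

text \<open>The last three rules are the decisive ones: a move leaves the current value of its
  component, and \<open>g\<close> is zero at every other value.\<close>

lemma vanishes_on_move:
  "vanishes_on the_L L g \<Longrightarrow> vanishes_on the_L L (move_P g)"
  "vanishes_on the_E E g \<Longrightarrow> vanishes_on the_E E (move_P g)"
  "vanishes_on the_E E g \<Longrightarrow> vanishes_on the_E E (move_L g)"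
  "supported_on the_P P g \<Longrightarrow> vanishes_on the_P P (move_P g)"
  "supported_on the_L L g \<Longrightarrow> vanishes_on the_L L (move_L g)"
  "supported_on the_E E g \<Longrightarrow> vanishes_on the_E E (move_E g)"
  by (auto simp: supported_on_def vanishes_on_def Ball_def flags_iff between_def intro!: sum.neutral)

text \<open>Each nontrivial word in normal form contains some letter exactly once, so the corresponding
  gallery changes that component of the flag and cannot close up.\<close>
lemma flag_basis_diagonal:
  fixes F :: "'a::{field,finite} flag"
  assumes F: "F \<in> flags" and i: "i < 24"
  shows "(flag.basis (\<lambda>G. of_bool (G = F)) ! i) F = of_bool (i = 0)"
proof (cases "i = 0")
  case True
  then show ?thesis by (simp add: flag.basis_def flag.basis_S3_def)
next
  case False
  obtain P L E where PLE: "F = (P, L, E)" by (cases F)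
  let ?d = "\<lambda>G. of_bool (G = F) :: int"
  have "supported_on the_P P ?d" "supported_on the_L L ?d" "supported_on the_E E ?d"
    by (auto simp: supported_on_def PLE)
  note rules = this supported_on_move vanishes_on_move
  have "vanishes_on the_P P (flag.basis ?d ! i) \<or> vanishes_on the_L L (flag.basis ?d ! i)
      \<or> vanishes_on the_E E (flag.basis ?d ! i)"
  proof -
    \<comment> \<open>In the order of \<open>basis\<close>, word 1 is \<open>X\<close> alone, words
      2 to 5 contain \<open>Y\<close> once and no \<open>Z\<close>, and all later words contain
      \<open>Z\<close> once.\<close>
    consider "i = 1" | "i \<in> {2, 3, 4, 5}" | "i \<in> {6..<24}"
      using i False by fastforce
    then show ?thesis
    proof cases
      case 1
      then show ?thesis by (simp add: flag.basis_def flag.basis_S3_def rules)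
    next
      case 2
      then show ?thesis by (auto simp: flag.basis_def flag.basis_S3_def rules)
    next
      case 3
      have "\<forall>g\<in>set (drop 6 (flag.basis ?d)). vanishes_on the_E E g"
        by (simp add: flag.basis_def flag.basis_S3_def rules)
      moreover have "length (flag.basis ?d) = 24"
        by (simp add: flag.basis_def flag.basis_S3_def)
      then have "flag.basis ?d ! i \<in> set (drop 6 (flag.basis ?d))"
        using 3 nth_mem[of "i - 6" "drop 6 (flag.basis ?d)"] by (simp add: less_diff_conv2)
      ultimately show ?thesis by blast
    qed
  qed
  then show ?thesis
    using F False by (auto simp: vanishes_on_def PLE)
qed

text \<open>Only the identity coordinate survives on the diagonal, so every flag contributes the
  same amount to the trace.\<close>

lemma flag_T_diagonal:
  fixes F :: "'a::{field,finite} flag"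
  assumes "F \<in> flags"
  shows "(flag.T ^^ k) (\<lambda>G. of_bool (G = F)) F = peval (int CARD('a)) ((mul_T ^^ k) one_coeffs ! 0)"
proof -
  have "(flag.T ^^ k) (\<lambda>G. of_bool (G = F)) F =
      (\<Sum>i<24. peval (int CARD('a)) ((mul_T ^^ k) one_coeffs ! i) * of_bool (i = 0))"
    unfolding flag.funpow_T flag.comb_def using assms
    by (intro sum.cong) (simp_all add: flag_basis_diagonal)
  also have "\<dots> = peval (int CARD('a)) ((mul_T ^^ k) one_coeffs ! 0)"
    by (subst sum.remove[of _ 0]) (auto intro!: sum.neutral)
  finally show ?thesis .
qed

text \<open>The components change in the order point, line, plane, each compatible with those
  already changed; in \<open>X (Y (Z g))\<close> the outermost operator makes the first
  move.\<close>

fun successors :: "'a::{field,finite} flag \<Rightarrow> 'a flag set" where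
  "successors (P, L, E) =
     (SIGMA P':between {0} L - {P}. SIGMA L':between P' E - {L}. between L' UNIV - {E})"

lemma successors_subset_flags: "F \<in> flags \<Longrightarrow> successors F \<subseteq> flags"
  by (cases F) (auto simp: flags_iff between_def)

lemma flag_T_eq_sum_successors:
  assumes "F \<in> flags"
  shows "flag.T g F = (\<Sum>G\<in>successors F. g G)"
proof -
  obtain P L E where F: "F = (P, L, E)" by (cases F)
  have "(P', L, E) \<in> flags" if "P' \<in> between {0} L" for P'
    using that assms by (auto simp: F flags_iff between_def)
  moreover have "(P', L', E) \<in> flags" if "P' \<in> between {0} L" "L' \<in> between P' E" for P' L'
    using that assms by (auto simp: F flags_iff between_def)
  ultimately show ?thesis
    using assms by (simp add: F flag.T_def sum.Sigma)
qed

section \<open>Closed walks\<close>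

text \<open>The starting vertex is marked, so that rotations count separately, as they do in a
  trace.\<close>

definition closed_walks :: "'f set \<Rightarrow> ('f \<Rightarrow> 'f set) \<Rightarrow> nat \<Rightarrow> 'f list set" where
  "closed_walks V S n = {w. length w = n \<and> set w \<subseteq> V \<and> (\<forall>i<n. w ! (Suc i mod n) \<in> S (w ! i))}"

text \<open>Powers of the adjacency operator count walks, by splitting off the first step. A walk of
  \<open>Suc n\<close> steps has the \<open>n\<close> interior vertices \<open>xs\<close>.\<close>

lemma card_paths:
  fixes V :: "'f::finite set" and T :: "('f \<Rightarrow> int) \<Rightarrow> 'f \<Rightarrow> int"
  assumes T: "\<And>g F. F \<in> V \<Longrightarrow> T g F = (\<Sum>G\<in>S F. g G)"
    and S: "\<And>F. F \<in> V \<Longrightarrow> S F \<subseteq> V" and F: "F \<in> V"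
  shows "(T ^^ Suc n) (\<lambda>H. of_bool (H = G)) F
    = int (card {xs. length xs = n \<and> successively (\<lambda>A B. B \<in> S A) (F # xs @ [G])})"
  using F
proof (induction n arbitrary: F)
  case 0
  have "{xs. length xs = 0 \<and> successively (\<lambda>A B. B \<in> S A) (F # xs @ [G])} =
      (if G \<in> S F then {[]} else {})"
    by auto
  then show ?case using 0 by (simp add: T of_bool_def sum.delta')
next
  case (Suc n)
  let ?W = "\<lambda>F n. {xs. length xs = n \<and> successively (\<lambda>A B. B \<in> S A) (F # xs @ [G])}"
  have W: "?W F (Suc n) = (\<lambda>(H, xs). H # xs) ` (SIGMA H:S F. ?W H n)"
  proof (intro equalityI subsetI)
    fix xs assume "xs \<in> ?W F (Suc n)"
    then obtain H ys where "xs = H # ys" "H \<in> S F" "ys \<in> ?W H n"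
      by (cases xs) auto
    then show "xs \<in> (\<lambda>(H, xs). H # xs) ` (SIGMA H:S F. ?W H n)" by force
  qed auto
  have fin: "finite (?W H n)" for H
    by (rule finite_subset[OF _ finite_lists_length_eq[of UNIV n]]) auto
  have "(T ^^ Suc (Suc n)) (\<lambda>H. of_bool (H = G)) F = (\<Sum>H\<in>S F. int (card (?W H n)))"
    using Suc.IH S[OF Suc.prems] by (subst funpow.simps) (auto simp: T[OF Suc.prems] intro!: sum.cong)
  also have "\<dots> = int (card (SIGMA H:S F. ?W H n))"
    using fin by simp
  also have "card (SIGMA H:S F. ?W H n) = card (?W F (Suc n))"
    unfolding W by (rule card_image[symmetric]) (auto simp: inj_on_def)
  finally show ?case .
qed

lemma card_closed_walks:
  fixes V :: "'f::finite set" and T :: "('f \<Rightarrow> int) \<Rightarrow> 'f \<Rightarrow> int"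
  assumes T: "\<And>g F. F \<in> V \<Longrightarrow> T g F = (\<Sum>G\<in>S F. g G)"
    and S: "\<And>F. F \<in> V \<Longrightarrow> S F \<subseteq> V" and n: "n > 0"
  shows "int (card (closed_walks V S n)) = (\<Sum>F\<in>V. (T ^^ n) (\<lambda>H. of_bool (H = F)) F)"
proof -
  obtain m where m: "n = Suc m" using n by (cases n) auto
  let ?W = "\<lambda>F. {xs. length xs = m \<and> successively (\<lambda>A B. B \<in> S A) (F # xs @ [F])}"
  \<comment> \<open>The path counts do not mention \<open>V\<close>; closure under \<open>S\<close>
    keeps the interior vertices inside it.\<close>
  have path_in: "set xs \<subseteq> V" if "successively (\<lambda>A B. B \<in> S A) (F # xs @ [G])" "F \<in> V" for F xs G
    using that
  proof (induction xs arbitrary: F)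
    case (Cons H xs)
    then have "H \<in> V" using S by auto
    with Cons show ?case by auto
  qed simp
  \<comment> \<open>Repeating the first vertex at the end turns the cyclic condition into a path
    condition; the index wraps only at \<open>i = m\<close>.\<close>
  have cyc: "successively (\<lambda>A B. B \<in> S A) (F # xs @ [F]) \<longleftrightarrow>
      (\<forall>i<n. (F # xs) ! (Suc i mod n) \<in> S ((F # xs) ! i))" if "length xs = m" for F xs
  proof -
    have "(F # xs) ! (Suc i mod n) = (F # xs @ [F]) ! Suc i" "(F # xs) ! i = (F # xs @ [F]) ! i"
      if "i < n" for i
      using that \<open>length xs = m\<close> m by (auto simp: nth_append nth_Cons mod_Suc split: nat.split)
    then show ?thesis
      using \<open>length xs = m\<close> m by (auto simp: successively_conv_nth)
  qed
  have "closed_walks V S n = (\<lambda>(F, xs). F # xs) ` (SIGMA F:V. ?W F)"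
  proof (intro equalityI subsetI)
    fix w assume w: "w \<in> closed_walks V S n"
    then obtain F xs where w_eq: "w = F # xs" and len: "length xs = m"
      using m by (cases w) (auto simp: closed_walks_def)
    with w have "F \<in> V" "xs \<in> ?W F"
      using cyc[OF len, of F] by (auto simp: closed_walks_def)
    then show "w \<in> (\<lambda>(F, xs). F # xs) ` (SIGMA F:V. ?W F)"
      using w_eq by force
  next
    fix w assume "w \<in> (\<lambda>(F, xs). F # xs) ` (SIGMA F:V. ?W F)"
    then obtain F xs where "w = F # xs" "F \<in> V" "xs \<in> ?W F" by auto
    then show "w \<in> closed_walks V S n"
      using cyc[of xs F] path_in[of F xs F] m by (auto simp: closed_walks_def)
  qed
  then have "card (closed_walks V S n) = card (SIGMA F:V. ?W F)"
    by (simp add: card_image inj_on_def)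
  moreover have "finite (?W F)" for F
    by (rule finite_subset[OF _ finite_lists_length_eq[of UNIV m]]) auto
  ultimately have "int (card (closed_walks V S n)) = (\<Sum>F\<in>V. int (card (?W F)))"
    by simp
  also have "\<dots> = (\<Sum>F\<in>V. (T ^^ n) (\<lambda>H. of_bool (H = F)) F)"
    unfolding m by (intro sum.cong refl card_paths[where V = V and S = S, OF T S, symmetric])
  finally show ?thesis .
qed

section \<open>Projective independence as a condition on dimension\<close>

lemma span_Un_span: "vec.span (vec.span A \<union> vec.span B) = vec.span (A \<union> B)"
  by (simp only: vec.span_Un vec.span_span)

lemma lift_span:
  assumes "p \<in> proj_points" "is_lift x p"
  shows "vec.span {x} = p"
proof (rule vec.subspace_dim_equal)
  show "vec.span {x} \<subseteq> p"
    using assms by (intro vec.span_minimal) (auto simp: proj_points_def is_lift_def)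
qed (use assms in \<open>auto simp: proj_points_def is_lift_def\<close>)

text \<open>Every family of lifts spans the same space as the points themselves, and a spanning list
  is distinct and independent exactly when its length is the dimension.\<close>

lemma proj_independent_iff_dim:
  assumes "set ps \<subseteq> proj_points"
  shows "proj_independent ps \<longleftrightarrow> vec.dim (\<Union>(set ps)) = length ps"
proof -
  have lifts: "distinct xs \<and> vec.independent (set xs) \<longleftrightarrow> vec.dim (\<Union>(set ps)) = length ps"
    if "list_all2 is_lift xs ps" for xs
  proof -
    have "vec.span (set xs) = vec.span (\<Union>(set ps))"
      using that assms
    proof (induction rule: list_all2_induct)
      case (Cons x xs p ps)
      have "vec.span (set (x # xs)) = vec.span (vec.span {x} \<union> vec.span (set xs))"
        by (simp add: span_Un_span)
      also have "\<dots> = vec.span (vec.span p \<union> vec.span (\<Union>(set ps)))"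
        using Cons lift_span[of p x] by (simp, metis vec.span_span)
      finally show ?case by (simp add: span_Un_span)
    qed simp
    then have dim: "vec.dim (\<Union>(set ps)) = vec.dim (set xs)"
      by (rule vec.span_eq_dim[symmetric])
    have len: "length xs = length ps" using that by (rule list_all2_lengthD)
    show ?thesis
    proof
      assume "distinct xs \<and> vec.independent (set xs)"
      then show "vec.dim (\<Union>(set ps)) = length ps"
        using dim len by (simp add: vec.dim_eq_card_independent distinct_card)
    next
      assume "vec.dim (\<Union>(set ps)) = length ps"
      then have "length xs \<le> card (set xs)"
        using vec.dim_le_card'[of "set xs"] dim len by simp
      then have "card (set xs) = length xs"
        using card_length[of xs] by simp
      moreover from this have "vec.independent (set xs)"
        using \<open>vec.dim (\<Union>(set ps)) = length ps\<close> dim len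
        by (intro vec.card_le_dim_spanning[of "set xs" "set xs"]) (auto simp: vec.span_superset)
      ultimately show "distinct xs \<and> vec.independent (set xs)"
        by (simp add: card_distinct)
    qed
  qed
  \<comment> \<open>Lifts exist, so the universal quantifier in \<open>proj_independent\<close> is
    not vacuous.\<close>
  have "\<exists>x. is_lift x p" if "p \<in> set ps" for p
  proof (rule ccontr)
    assume "\<not> ?thesis"
    then have "p \<subseteq> {0}" by (auto simp: is_lift_def)
    then have "vec.dim p \<noteq> 1" by (metis vec.dim_eq_0 zero_neq_one)
    with that assms show False by (auto simp: proj_points_def)
  qed
  then have "is_lift (SOME x. is_lift x p) p" if "p \<in> set ps" for p
    using that by (meson someI_ex)
  then have "list_all2 is_lift (map (\<lambda>p. SOME x. is_lift x p) ps) ps"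
    by (simp add: list.rel_map list.rel_refl_strong)
  with lifts show ?thesis
    unfolding proj_independent_def by blast
qed

section \<open>Closed walks on flags and tuples of points\<close>

text \<open>Old and new component are distinct and both have codimension one in the next larger
  component of the old flag, or in the whole space. This recovers lines and planes from
  points.\<close>

lemma successor_joins:
  assumes "(P, L, E) \<in> flags" "(P', L', E') \<in> successors (P, L, E)"
  shows "vec.span (P \<union> P') = L" "vec.span (L \<union> L') = E" "vec.span (E \<union> E') = UNIV"
proof -
  have "(P', L', E') \<in> flags"
    using assms successors_subset_flags by blast
  with assms show "vec.span (P \<union> P') = L" "vec.span (L \<union> L') = E" "vec.span (E \<union> E') = UNIV"
    by (intro span_Un_eq_of_codim_1; auto simp: flags_iff between_def)+
qed

definition flag_of :: "('a::{field,finite} ^ 4) set \<Rightarrow> ('a ^ 4) set \<Rightarrow> ('a ^ 4) set \<Rightarrow> 'a flag" where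
  "flag_of p1 p2 p3 = (p1, vec.span (p1 \<union> p2), vec.span (p1 \<union> p2 \<union> p3))"

lemma dim_Un_le: "vec.dim (A \<union> B) \<le> vec.dim A + vec.dim (B :: ('a::field ^ 'n) set)"
proof -
  have "vec.dim (vec.span (vec.span A \<union> vec.span B)) \<le> vec.dim (vec.span A) + vec.dim (vec.span B)"
    using dim_span_Un[OF vec.subspace_span vec.subspace_span, of A B] by linarith
  then show ?thesis by (simp add: span_Un_span)
qed

text \<open>By subadditivity of dimension, consecutive pairs and triples among the four points are
  independent too. A component shared by both flags would contain too many independent
  points.\<close>

lemma flag_of_in_flags:
  assumes p: "{p1, p2, p3, p4} \<subseteq> proj_points" and dim: "vec.dim (p1 \<union> p2 \<union> p3 \<union> p4) = 4"
  shows "flag_of p1 p2 p3 \<in> flags" "flag_of p2 p3 p4 \<in> flags"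
    and "flag_of p2 p3 p4 \<in> successors (flag_of p1 p2 p3)"
proof -
  have sub: "vec.subspace p1" "vec.subspace p2" "vec.subspace p3" "vec.subspace p4"
    and 1: "vec.dim p1 = 1" "vec.dim p2 = 1" "vec.dim p3 = 1" "vec.dim p4 = 1"
    using p by (auto simp: proj_points_def)
  have eq: "p1 \<union> p2 \<union> p3 \<union> p4 = p1 \<union> (p2 \<union> p3 \<union> p4)" by auto
  have 2: "vec.dim (p1 \<union> p2) = 2" "vec.dim (p2 \<union> p3) = 2"
    and 3: "vec.dim (p1 \<union> p2 \<union> p3) = 3" "vec.dim (p2 \<union> p3 \<union> p4) = 3"
    using dim 1 dim_Un_le[of p1 "p2 \<union> p3 \<union> p4"] dim_Un_le[of "p1 \<union> p2 \<union> p3" p4]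
      dim_Un_le[of "p1 \<union> p2" p3] dim_Un_le[of "p2 \<union> p3" p4] dim_Un_le[of p1 p2] dim_Un_le[of p2 p3]
    unfolding eq by linarith+
  have mono: "A \<subseteq> vec.span B" if "A \<subseteq> B" for A B :: "('a ^ 4) set"
    using that vec.span_superset by blast
  show F: "flag_of p1 p2 p3 \<in> flags" and G: "flag_of p2 p3 p4 \<in> flags"
    using sub 1 2 3 by (auto simp: flag_of_def flags_iff intro!: vec.span_mono mono[THEN subsetD])
  have "p2 \<noteq> p1" using 2 1 by auto
  moreover have "vec.span (p2 \<union> p3) \<noteq> vec.span (p1 \<union> p2)"
  proof
    assume *: "vec.span (p2 \<union> p3) = vec.span (p1 \<union> p2)"
    then have "p1 \<union> p2 \<union> p3 \<subseteq> vec.span (p1 \<union> p2)"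
      using * vec.span_superset[of "p1 \<union> p2"] vec.span_superset[of "p2 \<union> p3"] by auto
    from vec.dim_mono[OF this] 2 3 show False by simp
  qed
  moreover have "vec.span (p2 \<union> p3 \<union> p4) \<noteq> vec.span (p1 \<union> p2 \<union> p3)"
  proof
    assume *: "vec.span (p2 \<union> p3 \<union> p4) = vec.span (p1 \<union> p2 \<union> p3)"
    then have "p1 \<union> p2 \<union> p3 \<union> p4 \<subseteq> vec.span (p1 \<union> p2 \<union> p3)"
      using * vec.span_superset[of "p1 \<union> p2 \<union> p3"] vec.span_superset[of "p2 \<union> p3 \<union> p4"] by auto
    from vec.dim_mono[OF this] dim 3 show False by simp
  qed
  moreover have "p2 \<subseteq> vec.span (p1 \<union> p2)" "vec.span (p2 \<union> p3) \<subseteq> vec.span (p1 \<union> p2 \<union> p3)"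
    by (auto intro!: mono vec.span_mono)
  ultimately show "flag_of p2 p3 p4 \<in> successors (flag_of p1 p2 p3)"
    using G 1 2 3 sub by (auto simp: flag_of_def flags_iff between_def vec.subspace_0)
qed

text \<open>The points determine the walk: its lines and planes are the joins of two or three
  cyclically consecutive points, which gives the inverse map.\<close>

lemma bij_betw_closed_walks_C4:
  assumes n: "n \<ge> 4"
  shows "bij_betw (map fst) (closed_walks flags successors n) (C4 n :: ('a::{field,finite} ^ 4) set list set)"
proof (rule bij_betw_byWitness[where f' = "\<lambda>v. map (\<lambda>i. flag_of (v ! i) (v ! ((i + 1) mod n))
    (v ! ((i + 2) mod n))) [0..<n]"])
  have walk: "w ! i = flag_of (fst (w ! i)) (fst (w ! ((i + 1) mod n))) (fst (w ! ((i + 2) mod n)))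
      \<and> fst (w ! i) \<in> proj_points
      \<and> vec.dim (fst (w ! i) \<union> fst (w ! ((i + 1) mod n)) \<union> fst (w ! ((i + 2) mod n))
          \<union> fst (w ! ((i + 3) mod n))) = 4"
    if w: "w \<in> closed_walks flags successors n" and i: "i < n" for i and w :: "'a flag list"
  proof -
    have flag: "w ! (j mod n) \<in> flags" for j
    proof -
      have "j mod n < length w" using w n by (simp add: closed_walks_def)
      from nth_mem[OF this] w show ?thesis by (auto simp: closed_walks_def)
    qed
    have step: "w ! ((j + 1) mod n) \<in> successors (w ! (j mod n))" for j
    proof -
      have "w ! (Suc (j mod n) mod n) \<in> successors (w ! (j mod n))"
        using w n by (auto simp: closed_walks_def)
      then show ?thesis by (simp add: mod_simps)
    qed
    obtain P0 L0 E0 where 0: "w ! i = (P0, L0, E0)" by (cases "w ! i")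
    obtain P1 L1 E1 where 1: "w ! ((i + 1) mod n) = (P1, L1, E1)" by (cases "w ! ((i + 1) mod n)")
    obtain P2 L2 E2 where 2: "w ! ((i + 2) mod n) = (P2, L2, E2)" by (cases "w ! ((i + 2) mod n)")
    obtain P3 L3 E3 where 3: "w ! ((i + 3) mod n) = (P3, L3, E3)" by (cases "w ! ((i + 3) mod n)")
    have F: "(P0, L0, E0) \<in> flags" "(P1, L1, E1) \<in> flags" "(P2, L2, E2) \<in> flags"
      using flag[of i] flag[of "i + 1"] flag[of "i + 2"] i 0 1 2 by auto
    have S: "(P1, L1, E1) \<in> successors (P0, L0, E0)" "(P2, L2, E2) \<in> successors (P1, L1, E1)"
      "(P3, L3, E3) \<in> successors (P2, L2, E2)"
      using step[of i] step[of "i + 1"] step[of "i + 2"] i 0 1 2 3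
      by (auto simp: numeral_2_eq_2 numeral_3_eq_3 simp del: successors.simps)
    note J0 = successor_joins[OF F(1) S(1)] and J1 = successor_joins[OF F(2) S(2)]
      and J2 = successor_joins[OF F(3) S(3)]
    \<comment> \<open>\<open>E0\<close> is the join of \<open>L0\<close> and \<open>L1\<close>,
      themselves joins of consecutive points. In turn \<open>E0\<close> and \<open>E1\<close> join
      to the whole space, so the four points span it.\<close>
    have E0: "E0 = vec.span (P0 \<union> P1 \<union> P2)"
      using span_Un_span[of "P0 \<union> P1" "P1 \<union> P2"] J0 J1 by (simp add: Un_ac)
    have E1: "E1 = vec.span (P1 \<union> P2 \<union> P3)"
      using span_Un_span[of "P1 \<union> P2" "P2 \<union> P3"] J1 J2 by (simp add: Un_ac)
    have "vec.span (P0 \<union> P1 \<union> P2 \<union> P3) = UNIV"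
      using span_Un_span[of "P0 \<union> P1 \<union> P2" "P1 \<union> P2 \<union> P3"] J0 E0 E1 by (simp add: Un_ac)
    then have "vec.dim (P0 \<union> P1 \<union> P2 \<union> P3) = 4"
      using vec.dim_span[of "P0 \<union> P1 \<union> P2 \<union> P3"] by simp
    moreover have "P0 \<in> proj_points"
      using F(1) by (simp add: flags_iff proj_points_def)
    ultimately show ?thesis
      using J0 E0 unfolding 0 1 2 3 by (simp add: flag_of_def)
  qed
  have C4_point: "v ! (j mod n) \<in> proj_points" if "v \<in> C4 n" for j and v :: "('a ^ 4) set list"
  proof -
    have "j mod n < length v" using that n by (simp add: C4_def)
    from nth_mem[OF this] that show ?thesis by (auto simp: C4_def)
  qed
  have C4_dim: "vec.dim (v ! i \<union> v ! ((i + 1) mod n) \<union> v ! ((i + 2) mod n) \<union> v ! ((i + 3) mod n)) = 4"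
    if "v \<in> C4 n" "i < n" for i and v :: "('a ^ 4) set list"
  proof -
    have "{v ! i, v ! ((i + 1) mod n), v ! ((i + 2) mod n), v ! ((i + 3) mod n)} \<subseteq> proj_points"
      using C4_point[OF that(1)] C4_point[OF that(1), of i] that(2) by simp
    then show ?thesis
      using that proj_independent_iff_dim[of "[v ! i, v ! ((i + 1) mod n), v ! ((i + 2) mod n),
        v ! ((i + 3) mod n)]"] by (auto simp: C4_def Un_ac)
  qed
  show "\<forall>w\<in>closed_walks flags successors n. map (\<lambda>i. flag_of (map fst w ! i)
      (map fst w ! ((i + 1) mod n)) (map fst w ! ((i + 2) mod n))) [0..<n] = (w :: 'a flag list)"
  proof
    fix w :: "'a flag list" assume w: "w \<in> closed_walks flags successors n"
    then have len: "length w = n" by (simp add: closed_walks_def)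
    then show "map (\<lambda>i. flag_of (map fst w ! i) (map fst w ! ((i + 1) mod n))
        (map fst w ! ((i + 2) mod n))) [0..<n] = w"
      using walk[OF w] n by (auto intro!: nth_equalityI)
  qed
  show "\<forall>v\<in>C4 n. map fst (map (\<lambda>i. flag_of (v ! i) (v ! ((i + 1) mod n))
      (v ! ((i + 2) mod n))) [0..<n]) = (v :: ('a ^ 4) set list)"
    by (auto simp: flag_of_def C4_def intro!: nth_equalityI)
  show "map fst ` closed_walks flags successors n \<subseteq> (C4 n :: ('a ^ 4) set list set)"
  proof clarify
    fix w :: "'a flag list" assume w: "w \<in> closed_walks flags successors n"
    then have len: "length w = n" by (simp add: closed_walks_def)
    have pts: "set (map fst w) \<subseteq> proj_points"
    proof
      fix p assume "p \<in> set (map fst w)"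
      then obtain i where "i < n" "p = fst (w ! i)"
        unfolding in_set_conv_nth using len by auto
      with walk[OF w] show "p \<in> proj_points" by blast
    qed
    have "proj_independent [map fst w ! i, map fst w ! ((i + 1) mod n), map fst w ! ((i + 2) mod n),
        map fst w ! ((i + 3) mod n)]" if "i < n" for i
    proof -
      have "map fst w ! (j mod n) \<in> proj_points" for j
      proof -
        have "j mod n < length (map fst w)" using len n by simp
        from nth_mem[OF this] pts show ?thesis by blast
      qed
      from this[of i] this[of "i + 1"] this[of "i + 2"] this[of "i + 3"] that
      show ?thesis
        using walk[OF w that] len n by (subst proj_independent_iff_dim) (auto simp: Un_ac)
    qed
    with pts len show "map fst w \<in> C4 n" by (simp add: C4_def)
  qed
  show "(\<lambda>v. map (\<lambda>i. flag_of (v ! i) (v ! ((i + 1) mod n)) (v ! ((i + 2) mod n))) [0..<n]) `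
      (C4 n :: ('a ^ 4) set list set) \<subseteq> closed_walks flags successors n"
  proof clarify
    fix v :: "('a ^ 4) set list" assume v: "v \<in> C4 n"
    let ?F = "\<lambda>i. flag_of (v ! i) (v ! ((i + 1) mod n)) (v ! ((i + 2) mod n))"
    have *: "?F i \<in> flags \<and> ?F (Suc i mod n) \<in> successors (?F i)" if "i < n" for i
    proof -
      have pts: "{v ! i, v ! ((i + 1) mod n), v ! ((i + 2) mod n), v ! ((i + 3) mod n)} \<subseteq> proj_points"
        using C4_point[OF v] C4_point[OF v, of i] that by simp
      have "?F (Suc i mod n) = flag_of (v ! ((i + 1) mod n)) (v ! ((i + 2) mod n)) (v ! ((i + 3) mod n))"
        by (simp add: mod_simps numeral_2_eq_2 numeral_3_eq_3)
      with flag_of_in_flags[OF pts C4_dim[OF v that]] show ?thesis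
        by (simp only:)
    qed
    then show "map ?F [0..<n] \<in> closed_walks flags successors n"
      using n by (auto simp: closed_walks_def)
  qed
qed

section \<open>The counting formula\<close>

text \<open>The three cases in one expression that also covers the initial values. Its five summands
  belong to the irreducible representations: a generic degree times the power sum of the roots of
  the matching factor of the minimal polynomial. The halved exponent occurs for even
  \<open>n\<close> only, where it is exact.\<close>

definition closed_form :: "int \<Rightarrow> nat \<Rightarrow> int" where
  "closed_form q n = q ^ (3 * n) + (if 4 dvd n then 3 else -1) * (q ^ 3 + q ^ 2 + q) * q ^ (2 * n)
     + (if even n then 2 * (q ^ 4 + q ^ 2) * q ^ (3 * n div 2) else 0)
     + (if odd n then 1 else if 4 dvd n then 3 else -1) * (q ^ 5 + q ^ 4 + q ^ 3) * q ^ n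
     + (if even n then 1 else -1) * q ^ 6"

text \<open>The case distinctions depend on \<open>n\<close> modulo 4 only; with
  \<open>q ^ m\<close> as a second variable, all exponents are fixed for a given
  \<open>s\<close>.\<close>

lemma closed_form_shift:
  "closed_form q (4 * m + s) = (q ^ m) ^ 12 * q ^ (3 * s)
     + (if 4 dvd s then 3 else -1) * (q ^ 3 + q ^ 2 + q) * (q ^ m) ^ 8 * q ^ (2 * s)
     + (if even s then 2 * (q ^ 4 + q ^ 2) * (q ^ m) ^ 6 * q ^ (3 * s div 2) else 0)
     + (if odd s then 1 else if 4 dvd s then 3 else -1) * (q ^ 5 + q ^ 4 + q ^ 3) * (q ^ m) ^ 4 * q ^ s
     + (if even s then 1 else -1) * q ^ 6"
proof -
  have "3 * (4 * m + s) div 2 = 6 * m + 3 * s div 2" by simp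
  then show ?thesis
    by (simp add: closed_form_def power_add algebra_simps flip: power_mult)
qed

text \<open>Each summand is built from powers of roots of the minimal polynomial. For each residue
  modulo 4 this becomes a polynomial identity in \<open>q\<close> and \<open>x\<close>.\<close>

lemma closed_form_recurrence:
  "(\<Sum>k<11. peval q (minimal_coeffs ! k) * closed_form q (n + k)) = 0"
proof -
  define m r x where "m = n div 4" and "r = n mod 4" and "x = q ^ m"
  have n: "n + k = 4 * m + (r + k)" for k
    by (simp add: m_def r_def)
  have "r < 4" by (simp add: r_def)
  then consider "r = 0" | "r = 1" | "r = 2" | "r = 3" by linarith
  then show ?thesis
  proof cases
    case 1
    show ?thesis unfolding n 1 closed_form_shift x_def[symmetric]
      by (simp add: lessThan_nat_numeral minimal_coeffs_def numeral_2_eq_2[symmetric]) algebra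
  next
    case 2
    show ?thesis unfolding n 2 closed_form_shift x_def[symmetric]
      by (simp add: lessThan_nat_numeral minimal_coeffs_def numeral_2_eq_2[symmetric]) algebra
  next
    case 3
    show ?thesis unfolding n 3 closed_form_shift x_def[symmetric]
      by (simp add: lessThan_nat_numeral minimal_coeffs_def numeral_2_eq_2[symmetric]) algebra
  next
    case 4
    show ?thesis unfolding n 4 closed_form_shift x_def[symmetric]
      by (simp add: lessThan_nat_numeral minimal_coeffs_def numeral_2_eq_2[symmetric]) algebra
  qed
qed

text \<open>For \<open>q\<close> the size of the field, the left side is the trace of the
  \<open>k\<close>-th power. At \<open>k = 0\<close> it is the number of flags, and for
  \<open>k = 1, 2, 3\<close> both sides vanish.\<close>

lemma closed_form_initial:
  assumes "k < 10"
  shows "(\<Sum>i<4. q ^ i) * (\<Sum>i<3. q ^ i) * (\<Sum>i<2. q ^ i) * peval q ((mul_T ^^ k) one_coeffs ! 0)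
    = closed_form q k"
proof -
  have h: "(mul_T ^^ k) one_coeffs ! 0 = map (\<lambda>c. c ! 0) (iterates mul_T 10 one_coeffs) ! k"
    using assms by (simp add: iterates_nth)
  have N: "(\<Sum>i<4. q ^ i) * (\<Sum>i<3. q ^ i) * (\<Sum>i<2. q ^ i) =
      1 + 3 * q + 5 * q ^ 2 + 6 * q ^ 3 + 5 * q ^ 4 + 3 * q ^ 5 + q ^ 6"
    by (simp add: lessThan_nat_numeral) algebra
  let ?P = "\<lambda>k. (1 + 3 * q + 5 * q ^ 2 + 6 * q ^ 3 + 5 * q ^ 4 + 3 * q ^ 5 + q ^ 6) *
      peval q (map (\<lambda>c. c ! 0) (iterates mul_T 10 one_coeffs) ! k) = closed_form q k"
  have "?P 0" "?P 1" "?P 2" "?P 3" "?P 4" "?P 5" "?P 6" "?P 7" "?P 8" "?P 9"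
    unfolding unit_coefficients closed_form_def by (simp_all, algebra+)
  then have "?P k"
    using assms by (auto simp: numeral_eq_Suc less_Suc_eq)
  then show ?thesis
    unfolding h N .
qed

section \<open>Comparison of the two recurrent sequences\<close>

text \<open>A monic recurrence of order \<open>d\<close> determines each later term from the
  \<open>d\<close> preceding ones.\<close>

lemma linear_recurrence_unique:
  fixes a b m :: "nat \<Rightarrow> int"
  assumes a: "\<And>n. (\<Sum>k<Suc d. m k * a (n + k)) = 0" and b: "\<And>n. (\<Sum>k<Suc d. m k * b (n + k)) = 0"
    and monic: "m d = 1" and init: "\<And>k. k < d \<Longrightarrow> a k = b k"
  shows "a n = b n"
proof (induction n rule: less_induct)
  case (less n)
  show ?case
  proof (cases "n < d")
    case False
    then obtain l where l: "n = l + d" by (metis add.commute le_Suc_ex not_less)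
    have "(\<Sum>k<d. m k * a (l + k)) = (\<Sum>k<d. m k * b (l + k))"
      using less l by (intro sum.cong) auto
    with a[of l] b[of l] monic show ?thesis by (simp add: l)
  qed (rule init)
qed

lemma sum_flags_T_diagonal:
  "(\<Sum>F\<in>(flags :: 'a::{field,finite} flag set). (flag.T ^^ n) (\<lambda>H. of_bool (H = F)) F) =
     closed_form (int CARD('a)) n"
proof (rule linear_recurrence_unique[where d = 10
      and m = "\<lambda>k. peval (int CARD('a)) (minimal_coeffs ! k)"])
  let ?q = "int CARD('a)" and ?V = "flags :: 'a flag set"
  \<comment> \<open>The recurrence holds for each diagonal entry and is summed over the
    flags.\<close>
  show "(\<Sum>k<Suc 10. peval ?q (minimal_coeffs ! k) *
      (\<Sum>F\<in>?V. (flag.T ^^ (n + k)) (\<lambda>H. of_bool (H = F)) F)) = 0" for n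
    using flag.T_recurrence[where 'a = 'a, of n]
    by (simp add: sum_distrib_left sum.swap[of _ ?V])
  show "(\<Sum>k<Suc 10. peval ?q (minimal_coeffs ! k) * closed_form ?q (n + k)) = 0" for n
    using closed_form_recurrence[of ?q n] by simp
  show "peval ?q (minimal_coeffs ! 10) = 1"
    by (simp add: minimal_coeffs_def)
  show "(\<Sum>F\<in>?V. (flag.T ^^ k) (\<lambda>H. of_bool (H = F)) F) = closed_form ?q k" if "k < 10" for k
    using closed_form_initial[OF that, of ?q] by (simp add: flag_T_diagonal card_flags)
qed

lemma card_C4:
  assumes "n \<ge> 4"
  shows "int (card (C4 n :: ('a::{field,finite} ^ 4) set list set)) = closed_form (int CARD('a)) n"
proof -
  have "card (C4 n :: ('a ^ 4) set list set) = card (closed_walks (flags :: 'a flag set) successors n)"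
    by (rule bij_betw_same_card[OF bij_betw_closed_walks_C4[OF assms], symmetric])
  also have "int \<dots> = (\<Sum>F\<in>(flags :: 'a flag set). (flag.T ^^ n) (\<lambda>H. of_bool (H = F)) F)"
    using assms by (intro card_closed_walks flag_T_eq_sum_successors successors_subset_flags) auto
  finally show ?thesis by (simp add: sum_flags_T_diagonal)
qed

theorem theorem5p4:
  fixes n q :: nat
  assumes q: "q = CARD('a::{field,finite})"
    and n: "n \<ge> 4"
  shows "(gcd n 4 = 1 \<longrightarrow>
           int (card (C4 n :: ('a ^ 4) set list set)) =
             int q ^ (3 * n) - (int q ^ 3 + int q ^ 2 + int q) * int q ^ (2 * n)
             + (int q ^ 5 + int q ^ 4 + int q ^ 3) * int q ^ n - int q ^ 6) \<and>
         (gcd n 4 = 2 \<longrightarrow>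
           int (card (C4 n :: ('a ^ 4) set list set)) =
             int q ^ (3 * n) - (int q ^ 3 + int q ^ 2 + int q) * int q ^ (2 * n)
             + 2 * (int q ^ 4 + int q ^ 2) * int q ^ (3 * n div 2)
             - (int q ^ 5 + int q ^ 4 + int q ^ 3) * int q ^ n + int q ^ 6) \<and>
         (gcd n 4 = 4 \<longrightarrow>
           int (card (C4 n :: ('a ^ 4) set list set)) =
             int q ^ (3 * n) + 3 * (int q ^ 3 + int q ^ 2 + int q) * int q ^ (2 * n)
             + 2 * (int q ^ 4 + int q ^ 2) * int q ^ (3 * n div 2)
             + 3 * (int q ^ 5 + int q ^ 4 + int q ^ 3) * int q ^ n + int q ^ 6)"
proof -
  \<comment> \<open>The values of the gcd are translated into the divisibility tests of
    \<open>closed_form\<close>.\<close>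
  have "odd n" if "gcd n 4 = 1"
  proof
    assume "even n"
    then have "2 dvd gcd n 4" by simp
    with that show False by simp
  qed
  then have one: "odd n" "\<not> 4 dvd n" if "gcd n 4 = 1"
    using that by (auto dest: dvd_trans[of 2 4 n, rotated])
  have two: "even n" "\<not> 4 dvd n" if "gcd n 4 = 2"
    using that gcd_dvd1[of n 4] by (auto simp: gcd_nat.absorb2)
  have four: "even n" "4 dvd n" if "gcd n 4 = 4"
    using that gcd_dvd1[of n 4] by (auto intro: dvd_trans[of 2 4 n])
  have C4: "int (card (C4 n :: ('a ^ 4) set list set)) = closed_form (int q) n"
    using card_C4[OF n] q by simp
  show ?thesis
    unfolding C4 closed_form_def
  proof (intro conjI impI, goal_cases)
    case 1
    from one[OF this] show ?case by (simp add: algebra_simps)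
  next
    case 2
    from two[OF this] show ?case by (simp add: algebra_simps)
  next
    case 3
    from four[OF this] show ?case by (simp add: algebra_simps)
  qed
qed

end
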